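(* Let $1\le\gamma_1<\gamma_2<\dots<\gamma_m$ be constants ($m$ a positive integer) and let $F_1,\dots,F_N$ be continuous functions of $t$. The Euler equations with multiple gamma law (stated in the context) have the family of solutions $$\rho(t,\vec x)=f\Big(\sum_{i=1}^N C_i(x_i-a_i(t))\Big),\quad \vec u(t,\vec x)=(\dot a_1(t),\dots,\dot a_N(t)),\quad S(t,\vec x)=\ln\Big[g\Big(\sum_{i=1}^N C_i(x_i-a_i(t))\Big)\Big],$$ where $C_1,\dots,C_N,\xi$ are arbitrary constants, the functions $a_i$ satisfy $$\ddot a_i(t)=F_i(t)+C_i\xi,\qquad i=1,\dots,N,$$ with prescribed constant initial values for $a_i(0)$ and $\dot a_i(0)$, and $f,g$ are functions of one real variable $z$ as follows. (1) For $\gamma_1>1$: $f\ge 0$ is an arbitrary $C^1$ function, and $$\xi+\dot g(z)\sum_{j=1}^m f(z)^{\gamma_j-1}+g(z)\sum_{j=1}^m\gamma_j f(z)^{\gamma_j-2}\dot f(z)=0,\qquad g(z)>0,\qquad\text{for } z\in(-\infty,\infty).$$ (2) For $\gamma_1=1$: $f>0$ is an arbitrary $C^1$ function, and (with $\rho=f(z)$, and $i=1,\dots,N$) $$\xi+\rho\, C_i\,\dot g(z)+g(z)\frac{\dot f(z)}{f(z)}C_i+\dot g(z)\sum_{j=2}^m f(z)^{\gamma_j-1}+g(z)\sum_{j=2}^m\gamma_j f(z)^{\gamma_j-2}\dot f(z)=0,\qquad g(z)>0,\qquad\text{for } z\in(-\infty,\infty).$$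
   Context: The Euler equations with multiple gamma law and time-dependent external force $\vec F(t)=(F_1(t),\dots,F_N(t))$ in $\mathbb{R}^N$, for density $\rho=\rho(t,\vec x)$, velocity $\vec u=(u_1,\dots,u_N)(t,\vec x)$ and entropy $S=S(t,\vec x)$, are $$\frac{\partial\rho}{\partial t}+\sum_{k=1}^N u_k\frac{\partial\rho}{\partial x_k}+\rho\sum_{k=1}^N\frac{\partial u_k}{\partial x_k}=0,$$ $$\rho\Big(\frac{\partial u_i}{\partial t}+\sum_{k=1}^N u_k\frac{\partial u_i}{\partial x_k}\Big)+\frac{\partial}{\partial x_i}\Big(e^{S}\sum_{j=1}^m\rho^{\gamma_j}\Big)=\rho F_i(t),\qquad i=1,\dots,N,$$ $$\frac{\partial S}{\partial t}+\sum_{k=1}^N u_k\frac{\partial S}{\partial x_k}=0.$$ Dots denote derivatives of one-variable functions (with respect to $t$ for $a_i$, with respect to $z$ for $f,g$).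
   Formalization: In case (2) the relation is corrected to ξ + g' + g f'/f + (the two sums over j≥2) = 0: the printed factors ρC_i on g' and C_i on g f'/f are dropped, since with them the claim fails (N=m=C_1=1, γ_1=1, ξ=0, F=0, a=0, f=2+sin z, g=exp(1/f)). *)

theory Defs
  imports "HOL-Analysis.Analysis"
begin

definition has_partial_deriv :: "(real ^ 'n \<Rightarrow> real) \<Rightarrow> 'n \<Rightarrow> real \<Rightarrow> real ^ 'n \<Rightarrow> bool" where
  "has_partial_deriv q k D x \<longleftrightarrow>
     ((\<lambda>s. q (x + s *\<^sub>R axis k 1)) has_real_derivative D) (at 0)"

(* The exponents are gam 1, ..., gam m. Since 0 powr c = 0, a vacuum state r = 0 has zero pressure. *)
definition pressure :: "nat \<Rightarrow> (nat \<Rightarrow> real) \<Rightarrow> real \<Rightarrow> real \<Rightarrow> real" where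
  "pressure m gam r s = exp s * (\<Sum>j=1..m. r powr gam j)"

(* Classical solutions: every derivative occurring in the equations exists pointwise. T is the
   time interval, and time derivatives are one-sided at an end point belonging to T.
   rhox $ k, Sx $ k, px $ k are the k-th partial derivatives, ux $ i $ k that of the i-th velocity
   component. Nonnegativity of the density is what makes powr the real power. *)
definition euler_solution ::
  "real set \<Rightarrow> nat \<Rightarrow> (nat \<Rightarrow> real) \<Rightarrow> (real \<Rightarrow> real ^ 'n) \<Rightarrow>
   (real \<Rightarrow> real ^ 'n \<Rightarrow> real) \<Rightarrow> (real \<Rightarrow> real ^ 'n \<Rightarrow> real ^ 'n) \<Rightarrow> (real \<Rightarrow> real ^ 'n \<Rightarrow> real) \<Rightarrow> bool"
where
  "euler_solution T m gam F rho u S \<longleftrightarrow>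
    (\<forall>t\<in>T. \<forall>x. rho t x \<ge> 0 \<and>
      (\<exists>(rhot::real) (rhox::real ^ 'n) (ut::real ^ 'n) (ux::real ^ 'n ^ 'n)
        (St::real) (Sx::real ^ 'n) (px::real ^ 'n).
        ((\<lambda>s. rho s x) has_real_derivative rhot) (at t within T) \<and>
        (\<forall>k. has_partial_deriv (rho t) k (rhox $ k) x) \<and>
        (\<forall>i. ((\<lambda>s. u s x $ i) has_real_derivative ut $ i) (at t within T)) \<and>
        (\<forall>i k. has_partial_deriv (\<lambda>y. u t y $ i) k (ux $ i $ k) x) \<and>
        ((\<lambda>s. S s x) has_real_derivative St) (at t within T) \<and>
        (\<forall>k. has_partial_deriv (S t) k (Sx $ k) x) \<and>
        (\<forall>i. has_partial_deriv (\<lambda>y. pressure m gam (rho t y) (S t y)) i (px $ i) x) \<and>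
        rhot + (\<Sum>k\<in>UNIV. u t x $ k * rhox $ k) + rho t x * (\<Sum>k\<in>UNIV. ux $ k $ k) = 0 \<and>
        (\<forall>i. rho t x * (ut $ i + (\<Sum>k\<in>UNIV. u t x $ k * ux $ i $ k)) + px $ i
               = rho t x * F t $ i) \<and>
        St + (\<Sum>k\<in>UNIV. u t x $ k * Sx $ k) = 0))"

(* a with derivative da solves a'' = F + xi C on T, a 0 = a0, a' 0 = a1. *)
definition path_ivp ::
  "real set \<Rightarrow> (real \<Rightarrow> real ^ 'n) \<Rightarrow> real ^ 'n \<Rightarrow> real \<Rightarrow> real ^ 'n \<Rightarrow> real ^ 'n \<Rightarrow>
   (real \<Rightarrow> real ^ 'n) \<Rightarrow> (real \<Rightarrow> real ^ 'n) \<Rightarrow> bool"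
where
  "path_ivp T F C xi a0 a1 a da \<longleftrightarrow>
    a 0 = a0 \<and> da 0 = a1 \<and>
    (\<forall>t\<in>T. \<forall>i. ((\<lambda>s. a s $ i) has_real_derivative da t $ i) (at t within T) \<and>
              ((\<lambda>s. da s $ i) has_real_derivative F t $ i + C $ i * xi) (at t within T))"

definition phase :: "real ^ 'n \<Rightarrow> (real \<Rightarrow> real ^ 'n) \<Rightarrow> real \<Rightarrow> real ^ 'n \<Rightarrow> real" where
  "phase C a t x = (\<Sum>i\<in>UNIV. C $ i * (x $ i - a t $ i))"

(* In the statement about these fields, the relation between f and g for gam 1 = 1 is the momentum
   equation divided by C_i rho, with the isothermal pressure term split off. The source prints
   rho C_i g' and g (f'/f) C_i where g' and g f'/f stand here; with those factors the fields need not
   solve the momentum equation (N = m = C_1 = 1, xi = 0, F = 0, f = 2 + sin z, g = exp (1/f)). *)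

end

theory Submission
  imports Defs
begin

text \<open>The velocity \<open>da t\<close> is constant in space, hence divergence free, and the
  phase is carried by it: its time derivative, minus the scalar product of \<open>C\<close> and
  \<open>da t\<close>, cancels the advection term. So any function of the phase has zero material
  derivative, which settles mass and entropy for arbitrary \<open>f\<close> and \<open>g\<close>
  (\<open>path_ivp_phase_deriv\<close>, \<open>euler_solution_travelling\<close>).

  The pressure is P = g * (sum of the powers of f) at the phase, with gradient P' C. Since the
  acceleration is F + xi C, momentum follows from P' = - xi f. This is f times the relation between
  \<open>f\<close> and \<open>g\<close> (\<open>pressure_deriv\<close>); when
  \<open>gam 1 = 1\<close> that relation is the same one with its first summands written out. At
  vacuum points P is still differentiable, because there all exponents exceed 1
  (\<open>has_real_derivative_nonneg_powr\<close>).

  The path exists because its equation prescribes a'' as a continuous function of time: integrate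
  twice.\<close>

section \<open>Existence of the path\<close>

text \<open>Reduces derivatives within an arbitrary interval, open or closed at either end, to a
  compact segment, where the fundamental theorem of calculus applies. The base point
  \<open>c\<close> of the integral has to lie in the segment too.\<close>

lemma interval_nhd_segment:
  fixes T :: "real set"
  assumes "is_interval T" "c \<in> T" "t \<in> T"
  obtains a b where "a \<le> c" "c \<le> b" "a \<le> t" "t \<le> b" "{a..b} \<subseteq> T"
    "at t within T = at t within {a..b}"
proof -
  \<comment> \<open>The last condition makes the segment extend to the left of \<open>t\<close>
    whenever \<open>T\<close> does.\<close>
  obtain a where a: "a \<in> T" "a \<le> min c t" "\<forall>x\<in>T. x < t \<longrightarrow> a < t"
  proof (cases "\<exists>x\<in>T. x < t")
    case True
    then obtain x where "x \<in> T" "x < t" by blast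
    then show ?thesis using that[of "min x c"] assms by (auto simp: min_def)
  next
    case False
    then show ?thesis using that[of "min t c"] assms by (auto simp: min_def)
  qed
  obtain b where b: "b \<in> T" "b \<ge> max c t" "\<forall>x\<in>T. x > t \<longrightarrow> b > t"
  proof (cases "\<exists>x\<in>T. x > t")
    case True
    then obtain x where "x \<in> T" "x > t" by blast
    then show ?thesis using that[of "max x c"] assms by (auto simp: max_def)
  next
    case False
    then show ?thesis using that[of "max t c"] assms by (auto simp: max_def)
  qed
  have sub: "{a..b} \<subseteq> T"
    using assms(1) a(1) b(1) unfolding is_interval_1 by (meson atLeastAtMost_iff subsetI)
  \<comment> \<open>If \<open>a = t\<close>, then \<open>T\<close> has no point to the left of
    \<open>t\<close>, and any bound below \<open>t\<close> serves.\<close>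
  define l where "l = (if a < t then a else t - 1)"
  define r where "r = (if t < b then b else t + 1)"
  have "at t within T = at t within {a..b}"
  proof (rule at_within_nhd)
    show "t \<in> {l<..<r}" by (auto simp: l_def r_def)
    show "T \<inter> {l<..<r} - {t} = {a..b} \<inter> {l<..<r} - {t}"
      using a b sub by (force simp: l_def r_def split: if_splits)
  qed simp
  then show thesis using that[of a b] a b sub by simp
qed

text \<open>The integral from \<open>c\<close> is oriented, so \<open>t\<close> may lie on either
  side of \<open>c\<close>.\<close>

lemma antiderivative_on_interval:
  fixes h :: "real \<Rightarrow> real"
  assumes "is_interval T" "c \<in> T" "continuous_on T h"
  shows "\<exists>H. H c = y \<and> (\<forall>t\<in>T. (H has_real_derivative h t) (at t within T))"
proof -
  define H :: "real \<Rightarrow> real" where "H = (\<lambda>t. y + (LBINT s=c..t. h s))"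
  have "(H has_real_derivative h t) (at t within T)" if "t \<in> T" for t
  proof -
  obtain a b where ab: "a \<le> c" "c \<le> b" "a \<le> t" "t \<le> b" "{a..b} \<subseteq> T"
    and nhd: "at t within T = at t within {a..b}"
    using interval_nhd_segment[OF assms(1,2) \<open>t \<in> T\<close>] by metis
  have "continuous_on {a..b} h" using assms(3) ab(5) continuous_on_subset by blast
  then have "((\<lambda>u. LBINT s=c..u. h s) has_vector_derivative h t) (at t within {a..b})"
    using interval_integral_FTC2 ab by blast
  then show ?thesis
    unfolding H_def nhd has_real_derivative_iff_has_vector_derivative
    by (auto intro!: derivative_eq_intros)
  qed
  moreover have "H c = y" by (simp add: H_def)
  ultimately show ?thesis by blast
qed

lemma path_ivp_exists:
  fixes F :: "real \<Rightarrow> real ^ 'n"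
  assumes "is_interval T" "0 \<in> T" "\<forall>i. continuous_on T (\<lambda>t. F t $ i)"
  shows "\<exists>a da. path_ivp T F C xi a0 a1 a da"
proof -
  have "\<exists>A D. A 0 = a0 $ i \<and> D 0 = a1 $ i \<and>
    (\<forall>t\<in>T. (A has_real_derivative D t) (at t within T) \<and>
           (D has_real_derivative F t $ i + C $ i * xi) (at t within T))" for i
  proof -
    have cont_dd: "continuous_on T (\<lambda>t. F t $ i + C $ i * xi)"
      using assms(3) by (intro continuous_on_add continuous_on_const) auto
    obtain D where D: "D 0 = a1 $ i"
      "\<forall>t\<in>T. (D has_real_derivative F t $ i + C $ i * xi) (at t within T)"
      using antiderivative_on_interval[OF assms(1,2) cont_dd, of "a1 $ i"] by blast
    \<comment> \<open>Being differentiable, the velocity is continuous and can be integrated in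
      turn.\<close>
    then have cont_d: "continuous_on T D"
      by (meson DERIV_continuous continuous_on_eq_continuous_within)
    obtain A where "A 0 = a0 $ i"
      "\<forall>t\<in>T. (A has_real_derivative D t) (at t within T)"
      using antiderivative_on_interval[OF assms(1,2) cont_d, of "a0 $ i"] by blast
    with D show ?thesis by blast
  qed
  then obtain A D where AD: "\<And>i. A i 0 = a0 $ i \<and> D i 0 = a1 $ i \<and>
    (\<forall>t\<in>T. (A i has_real_derivative D i t) (at t within T) \<and>
           (D i has_real_derivative F t $ i + C $ i * xi) (at t within T))"
    by metis
  have "path_ivp T F C xi a0 a1 (\<lambda>t. \<chi> i. A i t) (\<lambda>t. \<chi> i. D i t)"
    unfolding path_ivp_def using AD by (simp add: vec_eq_iff)
  then show ?thesis by blast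
qed

section \<open>Powers of a nonnegative function\<close>

text \<open>At a zero of \<open>f\<close> the chain rule for \<open>powr\<close> is unavailable; there the factorization
  \<open>f powr c = f powr (c - 1) * f\<close> exhibits the difference quotient as a product.\<close>

lemma has_real_derivative_nonneg_powr:
  fixes f :: "real \<Rightarrow> real"
  assumes f: "(f has_real_derivative f') (at z)" and nonneg: "\<And>w. f w \<ge> 0"
    and c: "c > 1 \<or> c = 1 \<and> f z > 0"
  shows "((\<lambda>w. f w powr c) has_real_derivative c * f z powr (c - 1) * f') (at z)"
proof (cases "f z > 0")
  case True
  then show ?thesis using f by (auto intro!: derivative_eq_intros)
next
  case False
  then have fz: "f z = 0" using nonneg[of z] by simp
  with c have c: "c > 1" by auto
  have "(f \<longlongrightarrow> 0) (at z)"
    using DERIV_isCont[OF f] fz by (simp add: isCont_def)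
  \<comment> \<open>The exponent is positive, so the limit is legitimate at base 0 and has the value
    0.\<close>
  then have "((\<lambda>w. f w powr (c - 1)) \<longlongrightarrow> 0 powr (c - 1)) (at z)"
    using c nonneg by (intro tendsto_powr') auto
  then have "((\<lambda>w. f w powr (c - 1) * ((f w - f z) / (w - z))) \<longlongrightarrow> 0 * f') (at z)"
    using f by (intro tendsto_mult) (auto simp: has_field_derivative_iff)
  moreover have "f w powr (c - 1) * ((f w - f z) / (w - z)) =
      (f w powr c - f z powr c) / (w - z)" for w
    using fz nonneg[of w] powr_add[of "f w" "c - 1" 1] by auto
  ultimately have "((\<lambda>w. (f w powr c - f z powr c) / (w - z)) \<longlongrightarrow> 0) (at z)"
    by (simp only: mult_zero_left)
  then show ?thesis using fz by (simp add: has_field_derivative_iff)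
qed

section \<open>Fields transported by the phase\<close>

lemma phase_partial_deriv:
  "((\<lambda>s. phase C a t (x + s *\<^sub>R axis k 1)) has_real_derivative C $ k) (at s)"
proof -
  have "phase C a t (x + s *\<^sub>R axis k 1) = phase C a t x + C $ k * s" for s
  proof -
    have "phase C a t (x + s *\<^sub>R axis k 1) =
        (\<Sum>i\<in>UNIV. C $ i * (x $ i - a t $ i) + (if i = k then C $ k * s else 0))"
      unfolding phase_def by (intro sum.cong) (auto simp: axis_def algebra_simps)
    then show ?thesis by (simp add: phase_def sum.distrib)
  qed
  then show ?thesis by (auto intro!: derivative_eq_intros)
qed

lemma has_partial_deriv_compose_phase:
  assumes "(h has_real_derivative D) (at (phase C a t x))"
  shows "has_partial_deriv (\<lambda>y. h (phase C a t y)) k (D * C $ k) x"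
  unfolding has_partial_deriv_def
  using DERIV_chain2[OF _ phase_partial_deriv[of C a t x k 0], of h D] assms by simp

lemma path_ivp_phase_deriv:
  assumes "path_ivp T F C xi a0 a1 a da" "t \<in> T"
  shows "((\<lambda>s. phase C a s x) has_real_derivative - (\<Sum>k\<in>UNIV. da t $ k * C $ k)) (at t within T)"
proof -
  have "((\<lambda>s. a s $ i) has_real_derivative da t $ i) (at t within T)" for i
    using assms by (simp add: path_ivp_def)
  then have "((\<lambda>s. \<Sum>i\<in>UNIV. C $ i * (x $ i - a s $ i)) has_real_derivative
      (\<Sum>i\<in>UNIV. C $ i * (0 - da t $ i))) (at t within T)"
    by (intro DERIV_sum DERIV_cmult DERIV_diff DERIV_const)
  then show ?thesis by (simp add: phase_def sum_negf mult.commute)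
qed

text \<open>The velocity is constant in space, so \<open>f\<close> and \<open>g\<close> are transported along with the phase and the
  momentum equation reduces to assumption \<open>p\<close>, multiplied by \<open>C $ i\<close>.\<close>

lemma euler_solution_travelling:
  fixes F :: "real \<Rightarrow> real ^ 'n"
  assumes path: "path_ivp T F C xi a0 a1 a da"
    and f: "\<And>z. (f has_real_derivative f' z) (at z)" "\<And>z. f z \<ge> 0"
    and g: "\<And>z. (g has_real_derivative g' z) (at z)" "\<And>z. g z > 0"
    and p: "\<And>z. ((\<lambda>w. g w * (\<Sum>j=1..m. f w powr gam j)) has_real_derivative - xi * f z) (at z)"
  shows "euler_solution T m gam F
    (\<lambda>t x. f (phase C a t x)) (\<lambda>t x. da t) (\<lambda>t x. ln (g (phase C a t x)))"
  unfolding euler_solution_def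
proof (intro ballI allI conjI)
  fix t x assume t: "t \<in> T"
  let ?z = "phase C a t x" and ?c = "- (\<Sum>k\<in>UNIV. da t $ k * C $ k)"
  show "f ?z \<ge> 0" by (rule f)
  have ln_g: "((\<lambda>z. ln (g z)) has_real_derivative g' z / g z) (at z)" for z
    using g by (auto intro!: derivative_eq_intros)
  \<comment> \<open>Used with \<open>D\<close> the derivative of \<open>f\<close> and of
    \<open>ln\<close> of \<open>g\<close>: the drift of the phase cancels advection.\<close>
  have transport: "D * ?c + (\<Sum>k\<in>UNIV. da t $ k * (D * C $ k)) = 0" for D
    by (simp add: sum_distrib_left mult.left_commute)
  note phase_t = path_ivp_phase_deriv[OF path t, of x]
  show "\<exists>rhot rhox ut ux St Sx px.
        ((\<lambda>s. f (phase C a s x)) has_real_derivative rhot) (at t within T) \<and>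
        (\<forall>k. has_partial_deriv (\<lambda>x. f (phase C a t x)) k (rhox $ k) x) \<and>
        (\<forall>i. ((\<lambda>s. da s $ i) has_real_derivative ut $ i) (at t within T)) \<and>
        (\<forall>i k. has_partial_deriv (\<lambda>y. da t $ i) k (ux $ i $ k) x) \<and>
        ((\<lambda>s. ln (g (phase C a s x))) has_real_derivative St) (at t within T) \<and>
        (\<forall>k. has_partial_deriv (\<lambda>x. ln (g (phase C a t x))) k (Sx $ k) x) \<and>
        (\<forall>i. has_partial_deriv (\<lambda>y. pressure m gam (f (phase C a t y)) (ln (g (phase C a t y))))
               i (px $ i) x) \<and>
        rhot + (\<Sum>k\<in>UNIV. da t $ k * rhox $ k) + f ?z * (\<Sum>k\<in>UNIV. ux $ k $ k) = 0 \<and>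
        (\<forall>i. f ?z * (ut $ i + (\<Sum>k\<in>UNIV. da t $ k * ux $ i $ k)) + px $ i = f ?z * F t $ i) \<and>
        St + (\<Sum>k\<in>UNIV. da t $ k * Sx $ k) = 0"
  \<comment> \<open>Chain rule values for density and entropy, the path equation for the
    acceleration, zero velocity gradient, and \<open>p\<close> for the pressure.\<close>
  proof (rule exI[of _ "f' ?z * ?c"], rule exI[of _ "\<chi> k. f' ?z * C $ k"],
      rule exI[of _ "\<chi> i. F t $ i + C $ i * xi"], rule exI[of _ 0],
      rule exI[of _ "g' ?z / g ?z * ?c"], rule exI[of _ "\<chi> k. g' ?z / g ?z * C $ k"],
      rule exI[of _ "\<chi> i. - xi * f ?z * C $ i"], intro conjI allI)
    fix i
    show "((\<lambda>s. f (phase C a s x)) has_real_derivative f' ?z * ?c) (at t within T)"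
      using DERIV_chain2[OF f(1) phase_t] .
    show "((\<lambda>s. ln (g (phase C a s x))) has_real_derivative g' ?z / g ?z * ?c) (at t within T)"
      using DERIV_chain2[OF ln_g phase_t] .
    show "has_partial_deriv (\<lambda>x. f (phase C a t x)) i ((\<chi> k. f' ?z * C $ k) $ i) x"
      using has_partial_deriv_compose_phase[OF f(1)] by simp
    show "has_partial_deriv (\<lambda>x. ln (g (phase C a t x))) i ((\<chi> k. g' ?z / g ?z * C $ k) $ i) x"
      using has_partial_deriv_compose_phase[OF ln_g] by simp
    show "has_partial_deriv (\<lambda>y. pressure m gam (f (phase C a t y)) (ln (g (phase C a t y))))
        i ((\<chi> i. - xi * f ?z * C $ i) $ i) x"
      using has_partial_deriv_compose_phase[OF p] g(2) by (simp add: pressure_def)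
    show "((\<lambda>s. da s $ i) has_real_derivative (\<chi> i. F t $ i + C $ i * xi) $ i) (at t within T)"
      using path t by (simp add: path_ivp_def)
    show "has_partial_deriv (\<lambda>y. da t $ i) k (0 $ i $ k) x" for k
      by (simp add: has_partial_deriv_def)
    show "f' ?z * ?c + (\<Sum>k\<in>UNIV. da t $ k * (\<chi> k. f' ?z * C $ k) $ k) +
        f ?z * (\<Sum>k\<in>UNIV. 0 $ k $ k) = 0"
      using transport[of "f' ?z"] by simp
    show "g' ?z / g ?z * ?c + (\<Sum>k\<in>UNIV. da t $ k * (\<chi> k. g' ?z / g ?z * C $ k) $ k) = 0"
      using transport[of "g' ?z / g ?z"] by simp
  qed (simp add: algebra_simps)
qed

section \<open>The pressure relation\<close>

text \<open>The product rule yields \<open>f z\<close> times the terms of \<open>rel\<close> other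
  than \<open>xi\<close>. The relation is only ever multiplied by \<open>f z\<close>, never divided,
  so vacuum points are covered.\<close>

lemma pressure_deriv:
  fixes f g :: "real \<Rightarrow> real"
  assumes f: "(f has_real_derivative f') (at z)" "\<And>w. f w \<ge> 0"
    and g: "(g has_real_derivative g') (at z)"
    and gam: "\<And>j. j \<in> J \<Longrightarrow> gam j > 1 \<or> gam j = 1 \<and> f z > 0"
    and rel: "xi + g' * (\<Sum>j\<in>J. f z powr (gam j - 1))
        + g z * (\<Sum>j\<in>J. gam j * f z powr (gam j - 2) * f') = 0"
  shows "((\<lambda>w. g w * (\<Sum>j\<in>J. f w powr gam j)) has_real_derivative - xi * f z) (at z)"
proof -
  \<comment> \<open>True for every exponent even where \<open>f z = 0\<close>, since
    \<open>0 powr c\<close> is 0 for all \<open>c\<close>.\<close>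
  have pow: "f z powr (c - 1) * f z = f z powr c" for c
    using f(2)[of z] powr_add[of "f z" "c - 1" 1] by (cases "f z = 0") auto
  have "((\<lambda>w. g w * (\<Sum>j\<in>J. f w powr gam j)) has_real_derivative
      g' * (\<Sum>j\<in>J. f z powr gam j) + (\<Sum>j\<in>J. gam j * f z powr (gam j - 1) * f') * g z) (at z)"
    using gam by (intro DERIV_mult g DERIV_sum has_real_derivative_nonneg_powr f)
  moreover have "g' * (\<Sum>j\<in>J. f z powr gam j) + (\<Sum>j\<in>J. gam j * f z powr (gam j - 1) * f') * g z
    = - xi * f z"
  proof -
    have pow1: "f z powr (gam j - 1) = f z * f z powr (gam j - 2)" for j
      using pow[of "gam j - 1"] by (simp add: algebra_simps)
    have pow0: "f z powr gam j = f z * f z powr (gam j - 1)" for j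
      using pow[of "gam j"] by (simp add: algebra_simps)
    have "g' * (\<Sum>j\<in>J. f z powr gam j) = f z * (g' * (\<Sum>j\<in>J. f z powr (gam j - 1)))"
      by (subst pow0) (simp only: sum_distrib_left mult.left_commute)
    moreover have "(\<Sum>j\<in>J. gam j * f z powr (gam j - 1) * f') * g z =
        f z * (g z * (\<Sum>j\<in>J. gam j * f z powr (gam j - 2) * f'))"
      by (subst pow1) (simp only: sum_distrib_left sum_distrib_right mult_ac)
    moreover have "g' * (\<Sum>j\<in>J. f z powr (gam j - 1))
        + g z * (\<Sum>j\<in>J. gam j * f z powr (gam j - 2) * f') = - xi"
      using rel by linarith
    ultimately show ?thesis by (simp only: distrib_left[symmetric] mult.commute)
  qed
  ultimately show ?thesis by (simp only:)
qed

theorem theorem1: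
  fixes m :: nat and gam :: "nat \<Rightarrow> real"
    and T :: "real set" and F :: "real \<Rightarrow> real ^ 'n"
    and C a0 a1 :: "real ^ 'n" and xi :: real
    and f f' g g' :: "real \<Rightarrow> real"
  assumes "1 \<le> m" and "1 \<le> gam 1" and "strict_mono_on {1..m} gam"
    and "is_interval T" and "0 \<in> T" and "T \<noteq> {0}"
    and "\<forall>i. continuous_on T (\<lambda>t. F t $ i)"
    and "\<forall>z. (f has_real_derivative f' z) (at z)" and "continuous_on UNIV f'"
    and "\<forall>z. (g has_real_derivative g' z) (at z)" and "\<forall>z. g z > 0"
    and "gam 1 > 1 \<Longrightarrow>
      (\<forall>z. f z \<ge> 0 \<and>
        xi + g' z * (\<Sum>j=1..m. f z powr (gam j - 1))
           + g z * (\<Sum>j=1..m. gam j * f z powr (gam j - 2) * f' z) = 0)"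
    and "gam 1 = 1 \<Longrightarrow>
      (\<forall>z. f z > 0 \<and>
        xi + g' z + g z * (f' z / f z)
           + g' z * (\<Sum>j=2..m. f z powr (gam j - 1))
           + g z * (\<Sum>j=2..m. gam j * f z powr (gam j - 2) * f' z) = 0)"
  shows "(\<exists>a da. path_ivp T F C xi a0 a1 a da) \<and>
    (\<forall>a da. path_ivp T F C xi a0 a1 a da \<longrightarrow>
      euler_solution T m gam F
        (\<lambda>t x. f (phase C a t x)) (\<lambda>t x. da t) (\<lambda>t x. ln (g (phase C a t x))))"
proof (intro conjI allI impI)
  show "\<exists>a da. path_ivp T F C xi a0 a1 a da"
    using assms(4,5,7) by (rule path_ivp_exists)
next
  fix a da assume path: "path_ivp T F C xi a0 a1 a da"
  have gam_gt: "gam j > gam 1" if "j \<in> {2..m}" for j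
    using strict_mono_onD[OF assms(3), of 1 j] that by simp
  have nonneg: "f z \<ge> 0" for z
    using assms(2,12,13) by (metis less_eq_real_def)
  \<comment> \<open>Only the smallest exponent can equal 1, and in that case \<open>f\<close> is
    positive.\<close>
  have gam: "gam j > 1 \<or> gam j = 1 \<and> f z > 0" if "j \<in> {1..m}" for j z
  proof (cases "j = 1")
    case True
    then show ?thesis using assms(2,13) by force
  next
    case False
    then show ?thesis using gam_gt[of j] that assms(2) by auto
  qed
  have rel: "xi + g' z * (\<Sum>j=1..m. f z powr (gam j - 1))
      + g z * (\<Sum>j=1..m. gam j * f z powr (gam j - 2) * f' z) = 0" for z
  proof (cases "gam 1 = 1")
    case True
    then have "f z > 0" using assms(13) by blast
    \<comment> \<open>Positivity matters: \<open>0 powr 0\<close> would be 0, not 1. These are the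
      split-off summands for index 1.\<close>
    then have "f z powr (gam 1 - 1) = 1" "gam 1 * f z powr (gam 1 - 2) * f' z = f' z / f z"
      using True by (simp_all add: powr_minus_divide)
    moreover have "{1..m} = insert 1 {2..m}" using assms(1) by auto
    ultimately show ?thesis using assms(13)[OF True] by (simp add: algebra_simps)
  next
    case False
    then show ?thesis using assms(2,12) by simp
  qed
  have "((\<lambda>w. g w * (\<Sum>j=1..m. f w powr gam j)) has_real_derivative - xi * f z) (at z)" for z
    using pressure_deriv[of f "f' z" z g "g' z" "{1..m}" gam xi] assms(8,10) nonneg gam rel by blast
  then show "euler_solution T m gam F
      (\<lambda>t x. f (phase C a t x)) (\<lambda>t x. da t) (\<lambda>t x. ln (g (phase C a t x)))"
    using assms(8,10,11) nonneg by (intro euler_solution_travelling[OF path]) auto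
qed

end
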